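(* Let $\kappa>0$ and let $N\in\mathbb N$ be large enough that $4\kappa\sqrt{q_N}<1$ and $K:=2\sqrt{q_N}(\kappa+\epsilon)<1$, where $q_N:=\prod_{k=1}^N\frac{2k-1}{2k}$ and $$\epsilon:=\frac{1}{2\sqrt{q_N}}\sum_{n=2}^\infty\frac{1\cdot3\cdots(2n-3)}{2^n\,n!}\,(4\kappa\sqrt{q_N})^n .$$ Let $z_0\in P_N(\mathcal B)$ with $\|z_0\|\le\kappa$, and let $r_*\in(1-P_N)(\mathcal B)$ be the fixed point of $$F_{z_0}(r):=z_0\bullet z_0+2\,z_0\bullet r+r\bullet r$$ obtained as the limit of the iteration $r^{(0)}:=0$, $r^{(n+1)}:=F_{z_0}(r^{(n)})$. Suppose that $z_0$ satisfies $$z_0=z_0\circ z_0+2\,z_0\circ r_*+r_*\circ r_* .$$ Then $z_*:=z_0+r_*$ satisfies $z_*=z_*\times z_*$, and $$\|z_*-z_0\|<\frac{\sqrt{q_N}\,\kappa^2}{1-2\sqrt{q_N}(\kappa+\epsilon)} .$$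
   Context: Let $d>2$ be real, $\beta:=2^{-\frac{d+2}{2d}}$ (so $2\beta^2<1$) and $\rho:=\frac{\beta}{1-2\beta^2}$. For a real sequence $x=(x_0,x_1,x_2,\dots)$ put $\|x\|:=\sum_{n=0}^\infty|x_n|\rho^n$, and let $\mathcal B:=\{x\in\mathbb R^{\infty}:\|x\|<\infty\}$. The product $\times$ on $\mathcal B$ is $$(a\times b)_l:=\sum_{m,n\ge0,\ |m-n|\le l\le m+n}\beta^{l+m+n}B(l,m,n)\,a_mb_n,$$ $$B(l,m,n):=\sqrt{\frac{(2l)!}{(2m)!(2n)!}}\;\frac{(2m)!\,(2n)!}{(m+n-l)!\,(l+n-m)!\,(l+m-n)!}.$$ $P_N:\mathcal B\to\mathcal B$ is the projection $P_N(z_0,z_1,z_2,\dots):=(z_0,\dots,z_N,0,0,\dots)$; $a\circ b:=P_N(a\times b)$ and $a\bullet b:=(1-P_N)(a\times b)$. Under the stated conditions on $\kappa,N$ the iteration $r^{(n)}$ converges in $\mathcal B$ to a fixed point of $F_{z_0}$. *)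

theory Defs
  imports "HOL-Analysis.Analysis"
begin

definition beta :: "real \<Rightarrow> real" where
  "beta d = 2 powr (- ((d + 2) / (2 * d)))"

definition rho :: "real \<Rightarrow> real" where
  "rho d = beta d / (1 - 2 * (beta d)\<^sup>2)"

definition seq_space :: "real \<Rightarrow> (nat \<Rightarrow> real) set" where
  "seq_space d = {x. summable (\<lambda>n. \<bar>x n\<bar> * rho d ^ n)}"

text \<open>Only meaningful on \<open>seq_space d\<close>.\<close>

definition seq_norm :: "real \<Rightarrow> (nat \<Rightarrow> real) \<Rightarrow> real" where
  "seq_norm d x = (\<Sum>n. \<bar>x n\<bar> * rho d ^ n)"

definition converges_in_seq_space ::
    "real \<Rightarrow> (nat \<Rightarrow> nat \<Rightarrow> real) \<Rightarrow> (nat \<Rightarrow> real) \<Rightarrow> bool" where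
  "converges_in_seq_space d X x \<longleftrightarrow>
     (\<forall>n. X n \<in> seq_space d) \<and> x \<in> seq_space d \<and>
     (\<lambda>n. seq_norm d (\<lambda>l. X n l - x l)) \<longlonglongrightarrow> 0"

text \<open>The natural-number subtractions are exact for indices in \<open>triangle_set l\<close>.\<close>

definition Bcoef :: "nat \<Rightarrow> nat \<Rightarrow> nat \<Rightarrow> real" where
  "Bcoef l m n =
     sqrt (fact (2 * l) / (fact (2 * m) * fact (2 * n))) *
     (fact (2 * m) * fact (2 * n) /
       (fact (m + n - l) * fact (l + n - m) * fact (l + m - n)))"

definition triangle_set :: "nat \<Rightarrow> (nat \<times> nat) set" where
  "triangle_set l = {(m, n). \<bar>int m - int n\<bar> \<le> int l \<and> l \<le> m + n}"

text \<open>The double series is read as an unordered sum; for \<open>a\<close>, \<open>b\<close> in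
  \<open>seq_space d\<close> (with \<open>d > 2\<close>) it converges absolutely.\<close>

definition seq_times :: "real \<Rightarrow> (nat \<Rightarrow> real) \<Rightarrow> (nat \<Rightarrow> real) \<Rightarrow> nat \<Rightarrow> real" where
  "seq_times d a b l =
     (\<Sum>\<^sub>\<infinity>(m, n)\<in>triangle_set l. beta d ^ (l + m + n) * Bcoef l m n * a m * b n)"

definition proj :: "nat \<Rightarrow> (nat \<Rightarrow> real) \<Rightarrow> nat \<Rightarrow> real" where
  "proj N z = (\<lambda>n. if n \<le> N then z n else 0)"

definition coproj :: "nat \<Rightarrow> (nat \<Rightarrow> real) \<Rightarrow> nat \<Rightarrow> real" where
  "coproj N z = (\<lambda>n. z n - proj N z n)"

definition low_times ::
    "real \<Rightarrow> nat \<Rightarrow> (nat \<Rightarrow> real) \<Rightarrow> (nat \<Rightarrow> real) \<Rightarrow> nat \<Rightarrow> real" where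
  "low_times d N a b = proj N (seq_times d a b)"

definition high_times ::
    "real \<Rightarrow> nat \<Rightarrow> (nat \<Rightarrow> real) \<Rightarrow> (nat \<Rightarrow> real) \<Rightarrow> nat \<Rightarrow> real" where
  "high_times d N a b = coproj N (seq_times d a b)"

definition Fmap ::
    "real \<Rightarrow> nat \<Rightarrow> (nat \<Rightarrow> real) \<Rightarrow> (nat \<Rightarrow> real) \<Rightarrow> nat \<Rightarrow> real" where
  "Fmap d N z r =
     (\<lambda>l. high_times d N z z l + 2 * high_times d N z r l + high_times d N r r l)"

primrec Fiter :: "real \<Rightarrow> nat \<Rightarrow> (nat \<Rightarrow> real) \<Rightarrow> nat \<Rightarrow> nat \<Rightarrow> real" where
  "Fiter d N z 0 = (\<lambda>_. 0)"
| "Fiter d N z (Suc n) = Fmap d N z (Fiter d N z n)"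

definition qN :: "nat \<Rightarrow> real" where
  "qN N = (\<Prod>k=1..N. (2 * real k - 1) / (2 * real k))"

text \<open>The sum over \<open>n \<ge> 2\<close> is shifted to start at \<open>0\<close>; the product
  \<open>\<Prod>k=1..<n. 2 k - 1\<close> is \<open>1 \<cdot> 3 \<cdots> (2 n - 3)\<close>.\<close>

definition eps_term :: "real \<Rightarrow> nat \<Rightarrow> real" where
  "eps_term x n = (\<Prod>k=1..<n. 2 * real k - 1) / (2 ^ n * fact n) * x ^ n"

definition eps :: "real \<Rightarrow> nat \<Rightarrow> real" where
  "eps \<kappa> N = 1 / (2 * sqrt (qN N)) * (\<Sum>j. eps_term (4 * \<kappa> * sqrt (qN N)) (j + 2))"

end

(* The square of B(l,m,n) is a product of three binomial coefficients,
   C(2l, l+n-m) C(2m, i) C(2n, i) with i = m+n-l. The first is at most the central one,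
   C(2l, l) = 4^l q_l, and log-concavity of C(-, i) bounds the product of the other two by
   C(m+n, l)^2. The binomial theorem together with beta (1 + 2 beta rho) = rho then gives
   norm (a \<bullet> b) \<le> sqrt q_N * norm a * norm b. Summing the binomial series of
   sqrt (1 - x) shows that epsilon is the smaller root of sqrt q_N (kappa + e)^2 = e, so all
   iterates, and hence r_*, have norm at most epsilon. Reinserting this bound into
   norm r_* \<le> sqrt q_N (kappa + norm r_* )^2 gives the estimate. *)

theory Submission
  imports Defs
begin

section \<open>The numbers \<open>qN\<close> and an upper bound for \<open>Bcoef\<close>\<close>

lemma qN_pos: "qN N > 0"
  unfolding qN_def by (rule prod_pos) auto

lemma qN_Suc: "qN (Suc n) = qN n * ((2 * real n + 1) / (2 * real n + 2))"
  unfolding qN_def by (simp add: algebra_simps)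

lemma qN_antimono: "antimono qN"
proof (rule decseq_SucI)
  fix n
  have "(2 * real n + 1) / (2 * real n + 2) \<le> 1" by simp
  then show "qN (Suc n) \<le> qN n"
    unfolding qN_Suc using qN_pos[of n] by (intro mult_left_le) auto
qed

text \<open>Both sides are 1 at l = 0 and grow by the same factor 4 (2l+1) / (2l+2) from l to
  l+1.\<close>

lemma central_binomial_eq_qN: "real ((2 * l) choose l) = 4 ^ l * qN l"
proof (induction l)
  case 0
  show ?case by (simp add: qN_def)
next
  case (Suc l)
  have "real ((2 * Suc l) choose Suc l)
      = real ((2 * l) choose l) * (4 * ((2 * real l + 1) / (2 * real l + 2)))"
  proof -
    define y where "y = real l + 1"
    have y_pos: "y > 0" unfolding y_def by simp
    have "real ((2 * Suc l) choose Suc l) = fact (2 * Suc l) / (fact (Suc l) * fact (Suc l))"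
      by (subst binomial_fact) auto
    also have "\<dots> = fact (2 * l) / (fact l * fact l)
        * ((2 * y) * (2 * real l + 1) / (y * y))"
    proof -
      have "fact (2 * Suc l) = (2 * y) * (2 * real l + 1) * fact (2 * l)"
        unfolding y_def by (simp add: algebra_simps)
      moreover have "fact (Suc l) = y * fact l" unfolding y_def by simp
      ultimately show ?thesis by (simp only: times_divide_times_eq mult.left_commute mult.commute)
    qed
    also have "(2 * y) * (2 * real l + 1) / (y * y) = 4 * ((2 * real l + 1) / (2 * y))"
    proof -
      have "(2 * y) * c / (y * y) = 4 * (c / (2 * y))" for c
        using y_pos by (simp add: divide_simps)
      then show ?thesis .
    qed
    also have "2 * y = 2 * real l + 2" unfolding y_def by simp
    also have "fact (2 * l) / (fact l * fact l) = real ((2 * l) choose l)"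
      by (subst binomial_fact) auto
    finally show ?thesis .
  qed
  then show ?case unfolding Suc.IH qN_Suc by simp
qed

text \<open>Factor by factor this is (a-t)(b-t) \<le> ((a+b)/2 - t)^2. The hypotheses keep a-t and
  b-t nonnegative for all t < i, so the inequalities may be multiplied. It is applied to a = 2m and
  b = 2n, whose midpoint is the integer m+n.\<close>

lemma gbinomial_mult_le_midpoint:
  fixes a b :: real
  assumes "real i \<le> a + 1" "real i \<le> b + 1"
  shows "(a gchoose i) * (b gchoose i) \<le> (((a + b) / 2) gchoose i)\<^sup>2"
proof -
  have "(\<Prod>t = 0..<i. (a - real t) * (b - real t)) \<le> (\<Prod>t = 0..<i. ((a + b) / 2 - real t)\<^sup>2)"
  proof (rule prod_mono, intro conjI)
    fix t assume "t \<in> {0..<i}"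
    then have "real t + 1 \<le> real i" by auto
    then show "0 \<le> (a - real t) * (b - real t)" using assms by simp
    have "((a + b) / 2 - real t)\<^sup>2 - (a - real t) * (b - real t) = ((a - b) / 2)\<^sup>2"
      by (simp add: power2_eq_square field_simps)
    then show "(a - real t) * (b - real t) \<le> ((a + b) / 2 - real t)\<^sup>2"
      using zero_le_power2[of "(a - b) / 2"] by linarith
  qed
  then show ?thesis
    by (simp add: gbinomial_prod_rev power_divide prod.distrib prod_power_distrib
        power2_eq_square divide_right_mono)
qed

lemma Bcoef_nonneg: "Bcoef l m n \<ge> 0"
  unfolding Bcoef_def by simp

lemma Bcoef_commute: "Bcoef l m n = Bcoef l n m"
  unfolding Bcoef_def by (simp add: ac_simps)

lemma triangle_set_swap: "(m, n) \<in> triangle_set l \<longleftrightarrow> (n, m) \<in> triangle_set l"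
  unfolding triangle_set_def by auto

text \<open>In terms of i, j = l+n-m and k = l+m-n the three arguments are 2l = j+k, 2m = i+k and 2n
  = i+j. Squaring removes the root, and the factorials regroup into three binomial
  coefficients.\<close>

lemma Bcoef_squared:
  assumes "(m, n) \<in> triangle_set l"
  defines "i \<equiv> m + n - l"
  shows "(Bcoef l m n)\<^sup>2 = real ((2 * l) choose (l + n - m)) * real ((2 * m) choose i) * real ((2 * n) choose i)"
proof -
  define j k where "j = l + n - m" and "k = l + m - n"
  have e: "2 * l = j + k" "2 * m = i + k" "2 * n = i + j"
    using assms(1) unfolding triangle_set_def i_def j_def k_def by auto
  have "(Bcoef l m n)\<^sup>2 = fact (j + k) / (fact (i + k) * fact (i + j)) *
     (fact (i + k) * fact (i + j) / (fact i * fact j * fact k))\<^sup>2"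
    unfolding Bcoef_def power_mult_distrib e i_def[symmetric] j_def[symmetric] k_def[symmetric]
    by simp
  then show ?thesis
    unfolding e j_def[symmetric]
    by (simp add: binomial_fact power2_eq_square) (simp add: divide_simps)
qed

lemma Bcoef_le:
  assumes "(m, n) \<in> triangle_set l"
  shows "Bcoef l m n \<le> 2 ^ l * sqrt (qN l) * real ((m + n) choose l)"
proof -
  define i where "i = m + n - l"
  have le: "i \<le> 2 * m" "i \<le> 2 * n" "l \<le> m + n"
    using assms unfolding triangle_set_def i_def by auto
  have "real ((2 * m) choose i) * real ((2 * n) choose i) \<le> (real ((m + n) choose i))\<^sup>2"
  proof -
    have "real i \<le> real (2 * m) + 1" "real i \<le> real (2 * n) + 1" using le by linarith+
    from gbinomial_mult_le_midpoint[OF this] show ?thesis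
      by (simp add: binomial_gbinomial add_divide_distrib)
  qed
  \<comment> \<open>Symmetry turns the lower index i into l, so that the bound can later be summed
    over l by the binomial theorem.\<close>
  moreover have "(m + n) choose i = (m + n) choose l"
    unfolding i_def using binomial_symmetric[OF le(3)] by simp
  moreover have "real ((2 * l) choose (l + n - m)) \<le> real ((2 * l) choose l)"
    using binomial_maximum'[of l] by simp
  ultimately have "(Bcoef l m n)\<^sup>2 \<le> real ((2 * l) choose l) * (real ((m + n) choose l))\<^sup>2"
    unfolding Bcoef_squared[OF assms] i_def[symmetric] mult.assoc
    by (intro mult_mono) auto
  also have "\<dots> = (2 ^ l * sqrt (qN l) * real ((m + n) choose l))\<^sup>2"
    using less_imp_le[OF qN_pos[of l]]
    by (simp add: central_binomial_eq_qN power_mult_distrib flip: power_mult)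
      (simp add: power_mult mult.commute[of l])
  finally show ?thesis
    by (rule power2_le_imp_le) (simp add: less_imp_le[OF qN_pos])
qed

section \<open>The constants \<open>beta d\<close> and \<open>rho d\<close>, and the kernel of the
  product\<close>

lemma beta_pos: "beta d > 0"
  unfolding beta_def by simp

text \<open>The exponent in \<open>beta d\<close> is -1/2 - 1/d, so the left-hand side equals 2 to
  the power -2/d.\<close>

lemma two_beta_squared_less_1:
  assumes "d > 0"
  shows "2 * (beta d)\<^sup>2 < 1"
proof -
  define e where "e = - ((d + 2) / (2 * d))"
  have "e = - (1 / 2) - 1 / d" unfolding e_def using assms by (simp add: divide_simps)
  then have "1 + (e + e) < 0" using assms by simp
  then have "2 powr (1 + (e + e)) < 2 powr (0 :: real)" by (rule powr_less_mono) simp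
  then show ?thesis
    unfolding beta_def e_def[symmetric] powr_add by (simp add: power2_eq_square)
qed

lemma rho_pos: "d > 0 \<Longrightarrow> rho d > 0"
  unfolding rho_def using two_beta_squared_less_1[of d] beta_pos[of d] by simp

text \<open>This equation is what singles out the weight: summing the kernel over l produces powers
  of the left-hand side, which must again be powers of \<open>rho d\<close>.\<close>

lemma beta_mult_rho_eq:
  assumes "d > 0"
  shows "beta d * (1 + 2 * beta d * rho d) = rho d"
  unfolding rho_def using two_beta_squared_less_1[OF assms]
  by (simp add: divide_simps power2_eq_square)

text \<open>Extension by zero gives every l the same index set of pairs, so the sums over l and over
  pairs can be interchanged.\<close>

definition times_kernel :: "real \<Rightarrow> nat \<Rightarrow> nat \<times> nat \<Rightarrow> real" where
  "times_kernel d l p =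
     (if p \<in> triangle_set l then beta d ^ (l + fst p + snd p) * Bcoef l (fst p) (snd p) else 0)"

lemma times_kernel_nonneg: "times_kernel d l p \<ge> 0"
  unfolding times_kernel_def using beta_pos[of d] Bcoef_nonneg by simp

lemma times_kernel_swap: "times_kernel d l (prod.swap p) = times_kernel d l p"
  unfolding times_kernel_def
  using triangle_set_swap[of "fst p" "snd p" l] Bcoef_commute[of l "fst p" "snd p"]
  by (cases p) (simp add: ac_simps)

lemma seq_times_eq_infsum_kernel:
  "seq_times d a b l = (\<Sum>\<^sub>\<infinity>p. times_kernel d l p * (a (fst p) * b (snd p)))"
  unfolding seq_times_def
  by (rule infsum_cong_neutral) (auto simp: times_kernel_def)

text \<open>Since l \<ge> M, the factor \<open>qN l\<close> is at most \<open>qN M\<close>; what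
  remains is part of the binomial expansion of (1 + 2 beta rho)^(m+n). The case of a single l with M
  = 0 yields summability, and L beyond M = N yields the norm bound.\<close>

lemma times_kernel_sum_le:
  assumes "d > 0" "finite L" "\<And>l. l \<in> L \<Longrightarrow> M \<le> l"
  shows "(\<Sum>l\<in>L. times_kernel d l (m, n) * rho d ^ l) \<le> sqrt (qN M) * (rho d ^ m * rho d ^ n)"
proof -
  let ?b = "beta d" and ?r = "rho d"
  note pos = beta_pos[of d] rho_pos[OF assms(1)] qN_pos
  let ?t = "\<lambda>l. sqrt (qN M) * ?b ^ (m + n) * (real ((m + n) choose l) * (2 * ?b * ?r) ^ l)"
  have "times_kernel d l (m, n) * ?r ^ l \<le> ?t l" if "l \<in> L" for l
  proof (cases "(m, n) \<in> triangle_set l")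
    case True
    have "sqrt (qN l) \<le> sqrt (qN M)"
      using antimonoD[OF qN_antimono assms(3)[OF that]] by simp
    then have "Bcoef l m n \<le> 2 ^ l * sqrt (qN M) * real ((m + n) choose l)"
      by (intro order_trans[OF Bcoef_le[OF True]] mult_right_mono mult_left_mono) auto
    then have "?b ^ (l + m + n) * ?r ^ l * Bcoef l m n
        \<le> ?b ^ (l + m + n) * ?r ^ l * (2 ^ l * sqrt (qN M) * real ((m + n) choose l))"
      using pos by (intro mult_left_mono) auto
    then show ?thesis using True
      by (simp add: times_kernel_def power_mult_distrib power_add ac_simps)
  next
    case False
    then show ?thesis using pos by (simp add: times_kernel_def less_imp_le)
  qed
  then have "(\<Sum>l\<in>L. times_kernel d l (m, n) * ?r ^ l) \<le> (\<Sum>l\<in>L. ?t l)"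
    by (rule sum_mono)
  \<comment> \<open>Nonnegative terms are added to reach the full binomial sum; the terms with l >
    m+n are zero and are dropped next.\<close>
  also have "\<dots> \<le> (\<Sum>l\<in>L \<union> {..m + n}. ?t l)"
    using pos assms(2) by (intro sum_mono2) (auto simp: less_imp_le)
  also have "\<dots> = (\<Sum>l\<le>m + n. ?t l)"
    using assms(2) by (intro sum.mono_neutral_right) (auto simp: not_le binomial_eq_0)
  also have "\<dots> = sqrt (qN M) * ?b ^ (m + n) * (1 + 2 * ?b * ?r) ^ (m + n)"
    using binomial_ring[of "2 * ?b * ?r" 1 "m + n"]
    by (simp add: sum_distrib_left add.commute)
  also have "\<dots> = sqrt (qN M) * (?b * (1 + 2 * ?b * ?r)) ^ (m + n)"
    by (simp only: power_mult_distrib mult.assoc)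
  finally show ?thesis
    unfolding beta_mult_rho_eq[OF assms(1)] by (simp add: power_add)
qed

section \<open>Absolute convergence of the product\<close>

lemma has_sum_sum:
  fixes f :: "'i \<Rightarrow> 'a \<Rightarrow> 'b :: topological_comm_monoid_add"
  assumes "\<And>i. i \<in> I \<Longrightarrow> (f i has_sum s i) A"
  shows "((\<lambda>x. \<Sum>i\<in>I. f i x) has_sum (\<Sum>i\<in>I. s i)) A"
  using assms by (induction I rule: infinite_finite_induct) (auto intro!: has_sum_add)

lemma seq_space_has_sum:
  assumes "d > 0" "a \<in> seq_space d"
  shows "((\<lambda>n. \<bar>a n\<bar> * rho d ^ n) has_sum seq_norm d a) UNIV"
  using assms rho_pos[OF assms(1)] unfolding seq_space_def seq_norm_def
  by (intro norm_summable_imp_has_sum) (auto simp: summable_sums)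

lemma weighted_product_has_sum:
  assumes "d > 0" "a \<in> seq_space d" "b \<in> seq_space d"
  shows "((\<lambda>p. rho d ^ fst p * rho d ^ snd p * \<bar>a (fst p) * b (snd p)\<bar>)
           has_sum seq_norm d a * seq_norm d b) UNIV"
proof -
  note ha = seq_space_has_sum[OF assms(1,2)] and hb = seq_space_has_sum[OF assms(1,3)]
  have "((\<lambda>(m, n). (\<bar>a m\<bar> * rho d ^ m) * (\<bar>b n\<bar> * rho d ^ n))
      has_sum seq_norm d a * seq_norm d b) (UNIV \<times> UNIV)"
  proof (rule has_sum_SigmaI)
    show "((\<lambda>n. case (m, n) of (m, n) \<Rightarrow> (\<bar>a m\<bar> * rho d ^ m) * (\<bar>b n\<bar> * rho d ^ n))
        has_sum (\<bar>a m\<bar> * rho d ^ m) * seq_norm d b) UNIV" for m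
      using has_sum_cmult_right[OF hb] by simp
    then show "(\<lambda>(m, n). (\<bar>a m\<bar> * rho d ^ m) * (\<bar>b n\<bar> * rho d ^ n)) summable_on UNIV \<times> UNIV"
      using has_sum_imp_summable[OF has_sum_cmult_left[OF ha]] rho_pos[OF assms(1)]
      by (intro summable_on_SigmaI) (auto simp: less_imp_le)
    show "((\<lambda>m. (\<bar>a m\<bar> * rho d ^ m) * seq_norm d b) has_sum seq_norm d a * seq_norm d b) UNIV"
      by (rule has_sum_cmult_left[OF ha])
  qed
  then show ?thesis by (simp add: case_prod_unfold abs_mult ac_simps)
qed

lemma times_kernel_abs_summable:
  assumes "d > 0" "a \<in> seq_space d" "b \<in> seq_space d"
  shows "(\<lambda>p. times_kernel d l p * \<bar>a (fst p) * b (snd p)\<bar>) summable_on UNIV"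
proof -
  let ?w = "\<lambda>p. rho d ^ fst p * rho d ^ snd p * \<bar>a (fst p) * b (snd p)\<bar>"
  have "?w summable_on UNIV"
    using weighted_product_has_sum[OF assms] by (rule has_sum_imp_summable)
  then have s: "(\<lambda>p. inverse (rho d ^ l) * ?w p) summable_on UNIV"
    by (rule summable_on_cmult_right)
  show ?thesis
  proof (rule summable_on_comparison_test[OF s])
    fix p :: "nat \<times> nat"
    \<comment> \<open>\<open>qN 0\<close> is an empty product, hence 1: for fixed l the kernel is
      dominated by a constant multiple of the product weight.\<close>
    have "times_kernel d l p * rho d ^ l \<le> sqrt (qN 0) * (rho d ^ fst p * rho d ^ snd p)"
      using times_kernel_sum_le[OF assms(1), of "{l}" 0 "fst p" "snd p"] by simp
    then have "times_kernel d l p \<le> inverse (rho d ^ l) * (rho d ^ fst p * rho d ^ snd p)"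
      using rho_pos[OF assms(1)] by (simp add: field_simps qN_def)
    then show "times_kernel d l p * \<bar>a (fst p) * b (snd p)\<bar> \<le> inverse (rho d ^ l) * ?w p"
      unfolding mult.assoc[symmetric] by (rule mult_right_mono) simp
  qed (simp add: times_kernel_nonneg)
qed

lemma times_kernel_summable:
  assumes "d > 0" "a \<in> seq_space d" "b \<in> seq_space d"
  shows "(\<lambda>p. times_kernel d l p * (a (fst p) * b (snd p))) summable_on UNIV"
  by (rule abs_summable_summable)
    (use times_kernel_abs_summable[OF assms] in \<open>simp add: abs_mult times_kernel_nonneg\<close>)

section \<open>Symmetry and bilinearity of the product\<close>

lemma seq_times_commute: "seq_times d a b l = seq_times d b a l"
proof -
  have "seq_times d a b l = (\<Sum>\<^sub>\<infinity>p. times_kernel d l (prod.swap p) * (a (fst (prod.swap p)) * b (snd (prod.swap p))))"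
    unfolding seq_times_eq_infsum_kernel
    by (rule infsum_reindex_bij_betw[symmetric]) (rule bij_swap)
  then show ?thesis
    unfolding seq_times_eq_infsum_kernel by (simp add: times_kernel_swap mult.commute)
qed

lemma seq_times_add_left:
  assumes "d > 0" "a \<in> seq_space d" "b \<in> seq_space d" "c \<in> seq_space d"
  shows "seq_times d (\<lambda>n. a n + b n) c l = seq_times d a c l + seq_times d b c l"
  unfolding seq_times_eq_infsum_kernel
  using infsum_add[OF times_kernel_summable[OF assms(1,2,4)] times_kernel_summable[OF assms(1,3,4)], of l l]
  by (simp add: algebra_simps)

lemma seq_space_add:
  assumes "d > 0" "a \<in> seq_space d" "b \<in> seq_space d"
  shows "(\<lambda>n. a n + b n) \<in> seq_space d"
    and "seq_norm d (\<lambda>n. a n + b n) \<le> seq_norm d a + seq_norm d b"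
proof -
  note r = rho_pos[OF assms(1)]
  have le: "\<bar>a n + b n\<bar> * rho d ^ n \<le> \<bar>a n\<bar> * rho d ^ n + \<bar>b n\<bar> * rho d ^ n" for n
    unfolding distrib_right[symmetric] using r by (intro mult_right_mono) auto
  have sa: "summable (\<lambda>n. \<bar>a n\<bar> * rho d ^ n)" and sb: "summable (\<lambda>n. \<bar>b n\<bar> * rho d ^ n)"
    using assms unfolding seq_space_def by auto
  have s: "summable (\<lambda>n. \<bar>a n + b n\<bar> * rho d ^ n)"
    by (rule summable_comparison_test'[OF summable_add[OF sa sb], of 0]) (use le r in auto)
  then show "(\<lambda>n. a n + b n) \<in> seq_space d" unfolding seq_space_def by simp
  show "seq_norm d (\<lambda>n. a n + b n) \<le> seq_norm d a + seq_norm d b"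
    unfolding seq_norm_def suminf_add[OF sa sb]
    by (rule suminf_le[OF le s summable_add[OF sa sb]])
qed

lemma seq_times_square_add:
  assumes "d > 0" "a \<in> seq_space d" "b \<in> seq_space d"
  shows "seq_times d (\<lambda>n. a n + b n) (\<lambda>n. a n + b n) l
    = seq_times d a a l + 2 * seq_times d a b l + seq_times d b b l"
proof -
  let ?c = "\<lambda>n. a n + b n"
  have "seq_times d ?c ?c l = seq_times d a ?c l + seq_times d b ?c l"
    by (rule seq_times_add_left[OF assms seq_space_add(1)[OF assms]])
  also have "seq_times d a ?c l = seq_times d a a l + seq_times d b a l"
    unfolding seq_times_commute[of d a ?c] using assms by (intro seq_times_add_left)
  also have "seq_times d b ?c l = seq_times d a b l + seq_times d b b l"
    unfolding seq_times_commute[of d b ?c] using assms by (intro seq_times_add_left)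
  finally show ?thesis unfolding seq_times_commute[of d b a] by simp
qed

section \<open>Norm bounds for \<open>high_times\<close> and \<open>Fmap\<close>\<close>

lemma seq_norm_nonneg: "d > 0 \<Longrightarrow> a \<in> seq_space d \<Longrightarrow> seq_norm d a \<ge> 0"
  unfolding seq_norm_def seq_space_def using rho_pos[of d] by (auto intro!: suminf_nonneg)

lemma high_times_bound:
  assumes "d > 0" "a \<in> seq_space d" "b \<in> seq_space d"
  shows "high_times d N a b \<in> seq_space d"
    and "seq_norm d (high_times d N a b) \<le> sqrt (qN N) * seq_norm d a * seq_norm d b"
proof -
  let ?w = "\<lambda>p. \<bar>a (fst p) * b (snd p)\<bar>"
  note r = rho_pos[OF assms(1)]
  note ks = times_kernel_abs_summable[OF assms]
  have part: "(\<Sum>l<k. \<bar>high_times d N a b l\<bar> * rho d ^ l) \<le> sqrt (qN N) * seq_norm d a * seq_norm d b" for k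
  proof -
    \<comment> \<open>Only indices l > N survive the projection, which is the source of the small
      factor \<open>sqrt (qN N)\<close>.\<close>
    have "(\<Sum>l<k. \<bar>high_times d N a b l\<bar> * rho d ^ l) = (\<Sum>l\<in>{N<..<k}. \<bar>seq_times d a b l\<bar> * rho d ^ l)"
      by (rule sum.mono_neutral_cong_right) (auto simp: high_times_def coproj_def proj_def)
    also have "\<dots> \<le> (\<Sum>l\<in>{N<..<k}. \<Sum>\<^sub>\<infinity>p. times_kernel d l p * rho d ^ l * ?w p)"
    proof (rule sum_mono)
      fix l
      have "\<bar>seq_times d a b l\<bar> \<le> (\<Sum>\<^sub>\<infinity>p. times_kernel d l p * ?w p)"
        unfolding seq_times_eq_infsum_kernel
        using norm_infsum_bound[of "\<lambda>p. times_kernel d l p * (a (fst p) * b (snd p))" UNIV] ks[of l]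
        by (simp add: abs_mult times_kernel_nonneg)
      then have "\<bar>seq_times d a b l\<bar> * rho d ^ l \<le> (\<Sum>\<^sub>\<infinity>p. times_kernel d l p * ?w p) * rho d ^ l"
        using r by (intro mult_right_mono) auto
      also have "\<dots> = (\<Sum>\<^sub>\<infinity>p. times_kernel d l p * ?w p * rho d ^ l)"
        by (rule infsum_cmult_left[symmetric]) (rule ks)
      finally show "\<bar>seq_times d a b l\<bar> * rho d ^ l \<le> (\<Sum>\<^sub>\<infinity>p. times_kernel d l p * rho d ^ l * ?w p)"
        by (simp add: ac_simps)
    qed
    \<comment> \<open>As l runs over a finite set, its sum moves inside the sum over pairs, where
      \<open>times_kernel_sum_le\<close> applies to each pair.\<close>
    also have "\<dots> \<le> sqrt (qN N) * (seq_norm d a * seq_norm d b)"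
    proof (rule has_sum_mono)
      show "((\<lambda>p. \<Sum>l\<in>{N<..<k}. times_kernel d l p * rho d ^ l * ?w p)
          has_sum (\<Sum>l\<in>{N<..<k}. \<Sum>\<^sub>\<infinity>p. times_kernel d l p * rho d ^ l * ?w p)) UNIV"
        by (intro has_sum_sum has_sum_infsum)
          (use summable_on_cmult_left[OF ks] in \<open>simp add: ac_simps\<close>)
      show "((\<lambda>p. sqrt (qN N) * (rho d ^ fst p * rho d ^ snd p * ?w p))
          has_sum sqrt (qN N) * (seq_norm d a * seq_norm d b)) UNIV"
        by (intro has_sum_cmult_right weighted_product_has_sum assms)
      show "(\<Sum>l\<in>{N<..<k}. times_kernel d l p * rho d ^ l * ?w p)
          \<le> sqrt (qN N) * (rho d ^ fst p * rho d ^ snd p * ?w p)" for p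
        using mult_right_mono[OF times_kernel_sum_le[OF assms(1), of "{N<..<k}" N "fst p" "snd p"], of "?w p"]
        by (simp add: sum_distrib_right mult.assoc)
    qed
    also have "\<dots> = sqrt (qN N) * seq_norm d a * seq_norm d b" by simp
    finally show ?thesis .
  qed
  have nn: "0 \<le> \<bar>high_times d N a b l\<bar> * rho d ^ l" for l using r by simp
  have s: "summable (\<lambda>l. \<bar>high_times d N a b l\<bar> * rho d ^ l)"
    by (rule summableI_nonneg_bounded[OF nn part])
  then show "high_times d N a b \<in> seq_space d" unfolding seq_space_def by simp
  show "seq_norm d (high_times d N a b) \<le> sqrt (qN N) * seq_norm d a * seq_norm d b"
    unfolding seq_norm_def[of d "high_times d N a b"] by (rule suminf_le_const[OF s part])
qed

text \<open>The three terms of \<open>Fmap\<close> are the expansion of the high part of the square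
  of z + r, so one product estimate suffices.\<close>

lemma Fmap_bound:
  assumes "d > 0" "z \<in> seq_space d" "r \<in> seq_space d"
  shows "seq_norm d (Fmap d N z r) \<le> sqrt (qN N) * (seq_norm d z + seq_norm d r)\<^sup>2"
proof -
  have "Fmap d N z r = high_times d N (\<lambda>l. z l + r l) (\<lambda>l. z l + r l)"
    unfolding Fmap_def high_times_def coproj_def proj_def
    by (auto simp: seq_times_square_add[OF assms])
  then have "seq_norm d (Fmap d N z r) \<le> sqrt (qN N) * (seq_norm d (\<lambda>l. z l + r l))\<^sup>2"
    using high_times_bound(2)[OF assms(1) seq_space_add(1)[OF assms] seq_space_add(1)[OF assms], of N]
    by (simp add: power2_eq_square mult.assoc)
  also have "\<dots> \<le> sqrt (qN N) * (seq_norm d z + seq_norm d r)\<^sup>2"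
    using seq_space_add[OF assms] seq_norm_nonneg[OF assms(1)] qN_pos[of N]
    by (intro mult_left_mono power_mono) auto
  finally show ?thesis .
qed

section \<open>Closed form of \<open>eps\<close> and the bound on the iterates\<close>

lemma gbinomial_half_Suc:
  "((1 / 2 :: real) gchoose Suc n) * (-1) ^ Suc n = - (\<Prod>k=1..<Suc n. 2 * real k - 1) / (2 ^ Suc n * fact (Suc n))"
proof (induction n)
  case 0
  show ?case by simp
next
  case (Suc n)
  have "((1 / 2 :: real) gchoose Suc (Suc n)) = (1 / 2 gchoose Suc n) * ((1 / 2 - real (Suc n)) / real (Suc (Suc n)))"
    using gbinomial_mult_1[of "1 / 2 :: real" "Suc n"] by (simp add: field_simps)
  also have "\<dots> = (1 / 2 gchoose Suc n) * - ((2 * real (Suc n) - 1) / (2 * real (Suc (Suc n))))"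
    by (simp add: field_simps)
  finally have "((1 / 2 :: real) gchoose Suc (Suc n)) * (-1) ^ Suc (Suc n)
      = ((1 / 2 gchoose Suc n) * (-1) ^ Suc n) * ((2 * real (Suc n) - 1) / (2 * real (Suc (Suc n))))"
    by simp
  also have "\<dots> = - (\<Prod>k=1..<Suc (Suc n). 2 * real k - 1) / (2 ^ Suc (Suc n) * fact (Suc (Suc n)))"
    unfolding Suc.IH by simp
  finally show ?case .
qed

text \<open>From n = 1 on, \<open>eps_term x n\<close> is minus the n-th term of the binomial series
  of sqrt (1 - x). Starting at n = 2 splits off 1 - x/2.\<close>

lemma eps_term_sums:
  assumes "\<bar>x\<bar> < 1"
  shows "(\<lambda>j. eps_term x (j + 2)) sums (1 - x / 2 - sqrt (1 - x))"
proof -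
  have t: "eps_term x (Suc n) = - ((1 / 2 gchoose Suc n) * (- x) ^ Suc n)" for n
  proof -
    have "(1 / 2 gchoose Suc n) * (- x) ^ Suc n = ((1 / 2 gchoose Suc n) * (-1) ^ Suc n) * x ^ Suc n"
      by (subst power_minus) simp
    then show ?thesis unfolding eps_term_def gbinomial_half_Suc by simp
  qed
  have "(\<lambda>n. (1 / 2 gchoose n) * (- x) ^ n) sums (1 + (- x)) powr (1 / 2)"
    using assms by (intro gen_binomial_real) simp
  then have "(\<lambda>n. - ((1 / 2 gchoose n) * (- x) ^ n)) sums - sqrt (1 - x)"
    using assms by (intro sums_minus) (simp add: powr_half_sqrt)
  then have "(\<lambda>j. - ((1 / 2 gchoose (j + 2)) * (- x) ^ (j + 2)))
      sums (- sqrt (1 - x) - (\<Sum>n<2. - ((1 / 2 gchoose n) * (- x) ^ n)))"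
    by (subst sums_iff_shift) simp
  then show ?thesis
    using t[of "Suc _"] by (simp add: numeral_2_eq_2 algebra_simps)
qed

text \<open>With Q = \<open>sqrt (qN N)\<close>, the series evaluates \<open>eps\<close> to the
  smaller root of the quadratic Q (\<kappa> + e)^2 = e, whose discriminant is 1 - 4 \<kappa>
  Q.\<close>

lemma eps_fixed_point:
  assumes "\<kappa> > 0" "4 * \<kappa> * sqrt (qN N) < 1"
  shows "sqrt (qN N) * (\<kappa> + eps \<kappa> N)\<^sup>2 = eps \<kappa> N" and "eps \<kappa> N > 0"
proof -
  define Q where "Q = sqrt (qN N)"
  have Q: "Q > 0" unfolding Q_def using qN_pos by simp
  define s where "s = sqrt (1 - 4 * \<kappa> * Q)"
  have "\<bar>4 * \<kappa> * Q\<bar> < 1" using assms Q unfolding Q_def[symmetric] by simp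
  from sums_unique[OF eps_term_sums[OF this]]
  have e: "eps \<kappa> N = (1 - 2 * \<kappa> * Q - s) / (2 * Q)"
    unfolding eps_def Q_def[symmetric] s_def by (simp add: ac_simps)
  have s2: "s * s = 1 - 4 * \<kappa> * Q"
    unfolding s_def using assms Q unfolding Q_def[symmetric] by simp
  have "Q * (\<kappa> + (1 - 2 * \<kappa> * Q - s) / (2 * Q))\<^sup>2 = (1 - s)\<^sup>2 / (4 * Q)"
    using Q by (simp add: field_simps power2_eq_square)
  also have "(1 - s)\<^sup>2 = 2 * (1 - 2 * \<kappa> * Q - s)"
    using s2 by (simp add: power2_eq_square algebra_simps)
  also have "2 * c / (4 * Q) = c / (2 * Q)" for c by simp
  finally have fp: "Q * (\<kappa> + eps \<kappa> N)\<^sup>2 = eps \<kappa> N" unfolding e .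
  then show "sqrt (qN N) * (\<kappa> + eps \<kappa> N)\<^sup>2 = eps \<kappa> N" unfolding Q_def .
  \<comment> \<open>The sign is read off the fixed-point equation; since \<kappa> > 0, the same
    equation then gives strict positivity.\<close>
  have "eps \<kappa> N \<ge> 0" using fp Q by (metis less_imp_le mult_nonneg_nonneg zero_le_power2)
  then have "Q * (\<kappa> + eps \<kappa> N)\<^sup>2 > 0" using assms Q by simp
  then show "eps \<kappa> N > 0" unfolding fp .
qed

text \<open>The majorant t \<mapsto> Q (\<kappa> + t)^2, with Q = \<open>sqrt (qN N)\<close>, is
  increasing for t \<ge> 0 and fixes \<open>eps \<kappa> N\<close>, so the bound passes from one
  iterate to the next, starting from zero.\<close>

lemma Fiter_norm_le:
  assumes "d > 0" "\<kappa> > 0" "4 * \<kappa> * sqrt (qN N) < 1"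
    and "z \<in> seq_space d" "seq_norm d z \<le> \<kappa>" "\<And>n. Fiter d N z n \<in> seq_space d"
  shows "seq_norm d (Fiter d N z n) \<le> eps \<kappa> N"
proof (induction n)
  case 0
  show ?case using eps_fixed_point(2)[OF assms(2,3)] by (simp add: seq_norm_def)
next
  case (Suc n)
  have "seq_norm d (Fiter d N z (Suc n))
      \<le> sqrt (qN N) * (seq_norm d z + seq_norm d (Fiter d N z n))\<^sup>2"
    using Fmap_bound[OF assms(1,4,6)] by simp
  also have "\<dots> \<le> sqrt (qN N) * (\<kappa> + eps \<kappa> N)\<^sup>2"
    using Suc.IH assms(5) seq_norm_nonneg[OF assms(1)] assms(4,6) qN_pos[of N]
    by (intro mult_left_mono power_mono add_mono) auto
  finally show ?case unfolding eps_fixed_point(1)[OF assms(2,3)] .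
qed

section \<open>The limit \<open>rstar\<close> and the equation for \<open>zstar\<close>\<close>

lemma seq_norm_minus_commute: "seq_norm d (\<lambda>l. a l - b l) = seq_norm d (\<lambda>l. b l - a l)"
  unfolding seq_norm_def by (simp add: abs_minus_commute)

lemma seq_space_uminus: "a \<in> seq_space d \<Longrightarrow> (\<lambda>l. - a l) \<in> seq_space d"
  unfolding seq_space_def by simp

theorem corollary2p7p1:
  fixes d \<kappa> :: real and N :: nat
    and z0 rstar zstar :: "nat \<Rightarrow> real"
  assumes "d > 2"
    and "\<kappa> > 0"
    and "4 * \<kappa> * sqrt (qN N) < 1"
    and "2 * sqrt (qN N) * (\<kappa> + eps \<kappa> N) < 1"
    and "z0 \<in> proj N ` seq_space d"
    and "seq_norm d z0 \<le> \<kappa>"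
    and "rstar \<in> coproj N ` seq_space d"
    and "Fmap d N z0 rstar = rstar"
    and "converges_in_seq_space d (Fiter d N z0) rstar"
    and "z0 = (\<lambda>l. low_times d N z0 z0 l + 2 * low_times d N z0 rstar l
                     + low_times d N rstar rstar l)"
    and "zstar = (\<lambda>l. z0 l + rstar l)"
  shows "zstar = seq_times d zstar zstar \<and>
         seq_norm d (\<lambda>l. zstar l - z0 l)
           < sqrt (qN N) * \<kappa>\<^sup>2 / (1 - 2 * sqrt (qN N) * (\<kappa> + eps \<kappa> N))"
proof
  have d: "d > 0" using assms(1) by simp
  have it: "\<And>n. Fiter d N z0 n \<in> seq_space d"
    and rs: "rstar \<in> seq_space d"
    and lim: "(\<lambda>n. seq_norm d (\<lambda>l. Fiter d N z0 n l - rstar l)) \<longlonglongrightarrow> 0"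
    using assms(9) unfolding converges_in_seq_space_def by auto
  have zs: "z0 \<in> seq_space d"
  proof -
    obtain x where x: "z0 = proj N x" using assms(5) by auto
    then have "summable (\<lambda>n. \<bar>z0 n\<bar> * rho d ^ n)"
      by (intro summable_finite[of "{..N}"]) (auto simp: proj_def)
    then show ?thesis unfolding seq_space_def by simp
  qed
  show "zstar = seq_times d zstar zstar"
  proof
    fix l
    \<comment> \<open>The equation for \<open>z0\<close> supplies the low part of the square of
      \<open>zstar\<close>, the fixed-point equation the high part.\<close>
    have "zstar l = (low_times d N z0 z0 l + 2 * low_times d N z0 rstar l + low_times d N rstar rstar l)
        + Fmap d N z0 rstar l"
      using fun_cong[OF assms(10), of l] unfolding assms(8,11) by simp
    also have "\<dots> = seq_times d z0 z0 l + 2 * seq_times d z0 rstar l + seq_times d rstar rstar l"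
      unfolding Fmap_def low_times_def high_times_def coproj_def by simp
    also have "\<dots> = seq_times d zstar zstar l"
      unfolding assms(11) by (rule seq_times_square_add[OF d zs rs, symmetric])
    finally show "zstar l = seq_times d zstar zstar l" .
  qed
  define Q e R where "Q = sqrt (qN N)" and "e = eps \<kappa> N" and "R = seq_norm d rstar"
  have Q: "Q > 0" unfolding Q_def using qN_pos by simp
  have e: "e > 0" unfolding e_def using eps_fixed_point(2) assms(2,3) by blast
  have R0: "R \<ge> 0" unfolding R_def using seq_norm_nonneg[OF d rs] .
  have "R \<le> e"
  proof -
    have "R \<le> e + seq_norm d (\<lambda>l. Fiter d N z0 n l - rstar l)" for n
    proof -
      \<comment> \<open>\<open>rstar\<close> is split into the n-th iterate and an error whose norm
        tends to 0, so the bound on the iterates survives in the limit.\<close>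
      have "(\<lambda>l. rstar l + - Fiter d N z0 n l) \<in> seq_space d"
        by (intro seq_space_add seq_space_uminus d rs it)
      from seq_space_add(2)[OF d it[of n] this]
      have "R \<le> seq_norm d (Fiter d N z0 n) + seq_norm d (\<lambda>l. Fiter d N z0 n l - rstar l)"
        unfolding R_def seq_norm_minus_commute[of d "Fiter d N z0 n"] by simp
      then show ?thesis
        using Fiter_norm_le[OF d assms(2,3) zs assms(6) it, of n] unfolding e_def by linarith
    qed
    moreover have "(\<lambda>n. e + seq_norm d (\<lambda>l. Fiter d N z0 n l - rstar l)) \<longlonglongrightarrow> e + 0"
      by (intro tendsto_intros lim)
    ultimately show ?thesis
      using LIMSEQ_le_const[of _ e R] by auto
  qed
  have "R \<le> Q * (seq_norm d z0 + R)\<^sup>2"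
    using Fmap_bound[OF d zs rs, of N] unfolding assms(8) R_def Q_def .
  also have "\<dots> \<le> Q * (\<kappa> + R)\<^sup>2"
    using Q R0 assms(6) seq_norm_nonneg[OF d zs] by (intro mult_left_mono power_mono) auto
  \<comment> \<open>Expanding the square and moving the terms containing R to the left keeps only Q
    \<kappa>^2 on the right.\<close>
  finally have main: "R * (1 - 2 * Q * \<kappa> - Q * R) \<le> Q * \<kappa>\<^sup>2"
    by (simp add: power2_eq_square algebra_simps)
  have K: "0 < 1 - 2 * Q * (\<kappa> + e)" using assms(4) unfolding Q_def e_def by simp
  have "R * (1 - 2 * Q * (\<kappa> + e)) < Q * \<kappa>\<^sup>2"
  \<comment> \<open>If R = 0, strictness comes from Q \<kappa>^2 > 0. Otherwise it comes from the
    slack between Q R \<le> Q e and the 2 Q e of the claim, since e > 0.\<close>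
  proof (cases "R = 0")
    case True
    then show ?thesis using Q assms(2) by simp
  next
    case False
    have "Q * R < 2 * (Q * e)"
      using mult_left_mono[OF \<open>R \<le> e\<close>, of Q] mult_pos_pos[OF Q e] Q by linarith
    then have "1 - 2 * Q * (\<kappa> + e) < 1 - 2 * Q * \<kappa> - Q * R" by (simp add: algebra_simps)
    then have "R * (1 - 2 * Q * (\<kappa> + e)) < R * (1 - 2 * Q * \<kappa> - Q * R)"
      using False R0 by (intro mult_strict_left_mono) auto
    then show ?thesis using main by linarith
  qed
  then have "R < Q * \<kappa>\<^sup>2 / (1 - 2 * Q * (\<kappa> + e))"
    using K by (simp add: pos_less_divide_eq)
  then show "seq_norm d (\<lambda>l. zstar l - z0 l)
      < sqrt (qN N) * \<kappa>\<^sup>2 / (1 - 2 * sqrt (qN N) * (\<kappa> + eps \<kappa> N))"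
    unfolding assms(11) R_def Q_def e_def by simp
qed

end
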